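(* Let $C^0,\dots,C^d$ and $\delta_k: C^k\to C^{k+1}$ ($0\le k\le d-1$) be the graph cochain spaces and coboundary operators of a finite clique complex, let $\delta_k^*:C^{k+1}\to C^k$ be the transpose of $\delta_k$, let $\mathbf{D}_k$ ($0\le k\le d$) be diagonal matrices with positive diagonal entries acting on $C^k$, and set $\mathsf{d}_k^* := \mathbf{D}_k^{-1}\,\delta_k^*\,\mathbf{D}_{k+1}: C^{k+1}\to C^k$. If the sequence $$C^0\xrightarrow{\ \delta_0\ }C^1\xrightarrow{\ \delta_1\ }\cdots\xrightarrow{\ \delta_{d-1}\ }C^d$$ is exact, i.e. $\ker(\delta_k)=\operatorname{im}(\delta_{k-1})$ for all $1\le k\le d-1$, then the sequence $$C^d\xrightarrow{\ \mathsf{d}_{d-1}^*\ }\cdots\xrightarrow{\ \mathsf{d}_1^*\ }C^1\xrightarrow{\ \mathsf{d}_0^*\ }C^0$$ is exact, i.e. $\ker(\mathsf{d}_{k-1}^* )=\operatorname{im}(\mathsf{d}_{k}^* )$ for all $1\le k\le d-1$. Moreover $\mathsf{d}_k^*\circ\mathsf{d}_{k+1}^*=0$ for all $0\le k\le d-2$.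
   Context: Fix $d\ge 1$, a finite node set, and a finite family of cliques (nonempty sets of at most $d+1$ nodes) that is closed under taking nonempty subsets (a simplicial complex). $C^k$ is the finite-dimensional real vector space of $k$-cochains: alternating real-valued functions $\phi$ on ordered $(k+1)$-cliques, $\phi_{i_{\pi(0)}\cdots i_{\pi(k)}}=\operatorname{sgn}(\pi)\,\phi_{i_0\cdots i_k}$. Fixing one orientation for each $(k+1)$-clique identifies $C^k$ with $\mathbb{R}^{N_k}$, where $N_k$ is the number of $(k+1)$-cliques; diagonal matrices and transposes are taken in these coordinates. The coboundary is $$(\delta_k\phi)_{i_0\cdots i_{k+1}}=\sum_{j=0}^{k+1}(-1)^j\phi_{i_0\cdots\widehat{i_j}\cdots i_{k+1}},$$ (so $(\delta_0\phi)_{ij}=\phi_j-\phi_i$ and $(\delta_1\phi)_{ijk}=\phi_{ij}+\phi_{jk}+\phi_{ki}$), and satisfies $\delta_{k+1}\circ\delta_k=0$. *)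

theory Defs
  imports
    "HOL-Combinatorics.Permutations"
    "Jordan_Normal_Form.Gauss_Jordan_Elimination"
begin

definition clique_complex :: "nat \<Rightarrow> 'v set \<Rightarrow> 'v set set \<Rightarrow> bool" where
  "clique_complex d V K \<longleftrightarrow>
     finite V \<and> K \<subseteq> Pow V \<and>
     (\<forall>\<sigma>\<in>K. \<sigma> \<noteq> {} \<and> card \<sigma> \<le> d + 1) \<and>
     (\<forall>\<sigma>\<in>K. \<forall>\<tau>. \<tau> \<noteq> {} \<longrightarrow> \<tau> \<subseteq> \<sigma> \<longrightarrow> \<tau> \<in> K)"

definition cliques :: "'v set set \<Rightarrow> nat \<Rightarrow> 'v set set" where
  "cliques K n = {\<sigma>\<in>K. card \<sigma> = n}"

definition ordered_cliques :: "'v set set \<Rightarrow> nat \<Rightarrow> 'v list set" where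
  "ordered_cliques K n = {xs. distinct xs \<and> length xs = n \<and> set xs \<in> K}"

(* C^k. A cochain is a function on all lists; its value outside the ordered (k+1)-cliques
   carries no information and is fixed to be 0, so that equality of cochains is equality of
   functions.  permute_list p [i_0,...,i_k] = [i_(p 0),...,i_(p k)]. *)
definition cochains :: "'v set set \<Rightarrow> nat \<Rightarrow> ('v list \<Rightarrow> real) set" where
  "cochains K k = {\<phi>.
     (\<forall>xs. xs \<notin> ordered_cliques K (k + 1) \<longrightarrow> \<phi> xs = 0) \<and>
     (\<forall>xs\<in>ordered_cliques K (k + 1). \<forall>p. p permutes {..<k + 1} \<longrightarrow>
        \<phi> (permute_list p xs) = of_int (sign p) * \<phi> xs)}"

definition omit_nth :: "nat \<Rightarrow> 'v list \<Rightarrow> 'v list" where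
  "omit_nth j xs = take j xs @ drop (Suc j) xs"

definition coboundary :: "'v set set \<Rightarrow> nat \<Rightarrow> ('v list \<Rightarrow> real) \<Rightarrow> 'v list \<Rightarrow> real" where
  "coboundary K k \<phi> xs =
     (if xs \<in> ordered_cliques K (k + 2)
      then \<Sum>j = 0..k + 1. (- 1) ^ j * \<phi> (omit_nth j xs) else 0)"

(* B k lists one ordering (orientation) of every (k+1)-clique, so it fixes coordinates on C^k;
   length (B k) is N_k. *)
definition orientation :: "'v set set \<Rightarrow> nat \<Rightarrow> (nat \<Rightarrow> 'v list list) \<Rightarrow> bool" where
  "orientation K d B \<longleftrightarrow>
     (\<forall>k\<le>d. distinct (B k) \<and> set (B k) \<subseteq> ordered_cliques K (k + 1) \<and>
            bij_betw set (set (B k)) (cliques K (k + 1)))"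

definition coords :: "(nat \<Rightarrow> 'v list list) \<Rightarrow> nat \<Rightarrow> ('v list \<Rightarrow> real) \<Rightarrow> real vec" where
  "coords B k \<phi> = vec (length (B k)) (\<lambda>i. \<phi> (B k ! i))"

(* The inverse of the identification of C^k with R^(N_k). *)
definition of_coords ::
    "'v set set \<Rightarrow> (nat \<Rightarrow> 'v list list) \<Rightarrow> nat \<Rightarrow> real vec \<Rightarrow> 'v list \<Rightarrow> real" where
  "of_coords K B k = the_inv_into (cochains K k) (coords B k)"

definition coboundary_mat ::
    "'v set set \<Rightarrow> (nat \<Rightarrow> 'v list list) \<Rightarrow> nat \<Rightarrow> real mat" where
  "coboundary_mat K B k =
     mat (length (B (k + 1))) (length (B k))
       (\<lambda>(i, j). coords B (k + 1)
                   (coboundary K k (of_coords K B k (unit_vec (length (B k)) j))) $ i)"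

definition positive_diagonal :: "nat \<Rightarrow> real mat \<Rightarrow> bool" where
  "positive_diagonal n D \<longleftrightarrow>
     D \<in> carrier_mat n n \<and> diagonal_mat D \<and> (\<forall>i<n. D $$ (i, i) > 0)"

definition weighted_codiff_mat ::
    "'v set set \<Rightarrow> (nat \<Rightarrow> 'v list list) \<Rightarrow> (nat \<Rightarrow> real mat) \<Rightarrow> nat \<Rightarrow> real mat" where
  "weighted_codiff_mat K B D k =
     the (mat_inverse (D k)) * transpose_mat (coboundary_mat K B k) * D (k + 1)"

(* The map d_k^* from C^(k+1) to C^k. *)
definition weighted_codiff ::
    "'v set set \<Rightarrow> (nat \<Rightarrow> 'v list list) \<Rightarrow> (nat \<Rightarrow> real mat) \<Rightarrow> nat \<Rightarrow>
     ('v list \<Rightarrow> real) \<Rightarrow> 'v list \<Rightarrow> real" where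
  "weighted_codiff K B D k \<psi> =
     of_coords K B k (weighted_codiff_mat K B D k *\<^sub>v coords B (k + 1) \<psi>)"

definition ker_on ::
    "('v list \<Rightarrow> real) set \<Rightarrow> (('v list \<Rightarrow> real) \<Rightarrow> 'v list \<Rightarrow> real) \<Rightarrow> ('v list \<Rightarrow> real) set" where
  "ker_on C T = {\<phi>\<in>C. T \<phi> = (\<lambda>_. 0)}"

end

theory Submission
  imports Defs "Jordan_Normal_Form.Determinant"
begin

text \<open>
  Fixing an orientation of every clique turns cochains into coordinate vectors and the coboundary
  maps into matrices \<open>M\<^sub>k\<close>, so the theorem is a statement about matrices. Two of
  its ingredients do not depend on the clique complex.

  The first is the duality between exactness of \<open>A\<close> followed by \<open>B\<close> and exactness of the
  transposes (\<open>transpose_kernel_in_range\<close>). If \<open>A\<^sup>T y = 0\<close>, then \<open>y\<close> is orthogonal to the range of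
  \<open>A\<close>, hence to the kernel of \<open>B\<close>. Subtracting from \<open>y\<close> its orthogonal projection onto the row
  space of \<open>B\<close> leaves a residual \<open>r\<close> in the kernel of \<open>B\<close>. This residual is orthogonal to \<open>y\<close> and to
  the row space, so \<open>r \<bullet> r = 0\<close>, and \<open>y\<close> lies in the row space, which is the range of \<open>B\<^sup>T\<close>.

  The second is that the weights change nothing essential
  (\<open>weighted_kernel_iff_range\<close>): in \<open>D\<^sub>k\<inverse> M\<^sub>k\<^sup>T D\<^sub>k\<^sub>+\<^sub>1\<close> the invertible
  factor on the left does not affect the kernel, and the one on the right does not affect the range,
  so both sides of the asserted equality are the images under \<open>D\<^sub>k\<inverse>\<close> of their unweighted
  counterparts.

  The complex supplies \<open>M\<^sub>k\<^sub>+\<^sub>1 M\<^sub>k = 0\<close>, and the fact that evaluation at the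
  chosen orientations really is an isomorphism onto coordinate space
  (\<open>coords_bij\<close>). For the coboundary the alternating sum over omitted entries is treated by
  recursion on the list: it satisfies \<open>\<delta>\<phi> (x # xs) = \<phi> xs - \<delta>(\<phi> (x # \<cdot>)) xs\<close>, which turns
  \<open>\<delta>\<delta> = 0\<close> and the preservation of the alternating property into short inductions in place of
  the usual manipulation of double sums. The signs of arbitrary permutations enter only where
  antisymmetry under adjacent swaps is shown to be the alternating property (\<open>cochains_iff\<close>).
\<close>

section \<open>Duality of exactness for real matrices\<close>

text \<open>
  The existence of an orthogonal projection onto the span of the vectors \<open>b 0, \<dots>, b (m - 1)\<close>,
  stated by its coefficients \<open>w\<close>. The induction is one step of the Gram-Schmidt process: the part
  \<open>s\<close> of the new vector that is orthogonal to the earlier ones is used to correct the residual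
  \<open>r\<close>, unless \<open>s\<close> vanishes.
\<close>

lemma ex_orthogonal_residual:
  fixes b :: "nat \<Rightarrow> nat \<Rightarrow> real"
  shows "\<exists>w. \<forall>j<m. (\<Sum>i<n. b j i * (y i - (\<Sum>l<m. w l * b l i))) = 0"
proof (induction m arbitrary: y)
  case 0
  show ?case by simp
next
  case (Suc m)
  obtain w where w: "\<And>j. j < m \<Longrightarrow> (\<Sum>i<n. b j i * (y i - (\<Sum>l<m. w l * b l i))) = 0"
    using Suc.IH[of y] by blast
  obtain u where u: "\<And>j. j < m \<Longrightarrow> (\<Sum>i<n. b j i * (b m i - (\<Sum>l<m. u l * b l i))) = 0"
    using Suc.IH[of "b m"] by blast
  define r where "r i = y i - (\<Sum>l<m. w l * b l i)" for i
  define s where "s i = b m i - (\<Sum>l<m. u l * b l i)" for i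
  have r: "(\<Sum>i<n. b j i * r i) = 0" and s: "(\<Sum>i<n. b j i * s i) = 0" if "j < m" for j
    using w[OF that] u[OF that] by (simp_all add: r_def s_def)
  have bm: "(\<Sum>i<n. b m i * f i) = (\<Sum>i<n. s i * f i)"
    if f: "\<And>j. j < m \<Longrightarrow> (\<Sum>i<n. b j i * f i) = 0" for f
  proof -
    have "(\<Sum>i<n. b m i * f i) - (\<Sum>i<n. s i * f i) = (\<Sum>i<n. \<Sum>l<m. u l * (b l i * f i))"
      by (simp add: s_def sum_subtractf[symmetric] left_diff_distrib sum_distrib_right mult.assoc)
    also have "\<dots> = (\<Sum>l<m. u l * (\<Sum>i<n. b l i * f i))"
      by (subst sum.swap) (simp add: sum_distrib_left)
    finally show ?thesis by (simp add: f)
  qed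
  show ?case
  proof (cases "(\<Sum>i<n. s i * s i) = 0")
    case True
    then have "\<And>i. i < n \<Longrightarrow> s i = 0"
      by (subst (asm) sum_nonneg_eq_0_iff) auto
    then have "(\<Sum>i<n. b m i * r i) = 0"
      by (subst bm) (auto simp: r)
    then have "\<forall>j<Suc m. (\<Sum>i<n. b j i * (y i - (\<Sum>l<Suc m. (w(m := 0)) l * b l i))) = 0"
      using r by (auto simp: less_Suc_eq r_def)
    then show ?thesis by blast
  next
    case False
    define c where "c = (\<Sum>i<n. b m i * r i) / (\<Sum>i<n. s i * s i)"
    define v where "v = (\<lambda>l. if l = m then c else w l - c * u l)"
    have v: "y i - (\<Sum>l<Suc m. v l * b l i) = r i - c * s i" for i
      by (simp add: v_def r_def s_def algebra_simps sum_subtractf sum_distrib_left)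
    have split: "(\<Sum>i<n. b j i * (r i - c * s i))
        = (\<Sum>i<n. b j i * r i) - c * (\<Sum>i<n. b j i * s i)" for j
      by (simp add: right_diff_distrib sum_subtractf sum_distrib_left mult.left_commute)
    have "(\<Sum>i<n. b m i * s i) = (\<Sum>i<n. s i * s i)"
      by (rule bm) (rule s)
    then have "(\<Sum>i<n. b m i * r i) = c * (\<Sum>i<n. b m i * s i)"
      using False by (simp add: c_def)
    then have "\<forall>j<Suc m. (\<Sum>i<n. b j i * (r i - c * s i)) = 0"
      unfolding split by (auto simp: less_Suc_eq r s)
    then show ?thesis
      by (intro exI[of _ v]) (simp only: v)
  qed
qed

lemma ex_row_space_projection:
  fixes B :: "real mat"
  assumes B: "B \<in> carrier_mat p n" and y: "y \<in> carrier_vec n"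
  shows "\<exists>w\<in>carrier_vec p. B *\<^sub>v (y - transpose_mat B *\<^sub>v w) = 0\<^sub>v p"
proof -
  obtain w where
    w: "\<And>j. j < p \<Longrightarrow> (\<Sum>i<n. B $$ (j, i) * (y $ i - (\<Sum>l<p. w l * B $$ (l, i)))) = 0"
    using ex_orthogonal_residual[where m=p and n=n and b="\<lambda>j i. B $$ (j, i)" and y="\<lambda>i. y $ i"] by blast
  have "B *\<^sub>v (y - transpose_mat B *\<^sub>v vec p w) = 0\<^sub>v p"
  proof (rule eq_vecI)
    fix j assume "j < dim_vec (0\<^sub>v p :: real vec)"
    then have j: "j < p" by simp
    show "(B *\<^sub>v (y - transpose_mat B *\<^sub>v vec p w)) $ j = 0\<^sub>v p $ j"
      using w[OF j] B y j
      by (simp add: scalar_prod_def atLeast0LessThan mult.commute)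
  qed (use B in auto)
  then show ?thesis by (intro bexI[of _ "vec p w"]) auto
qed

text \<open>Real coefficients enter through \<open>r \<bullet> r = 0 \<Longrightarrow> r = 0\<close>, applied to the residual of the
  projection of \<open>y\<close> onto the row space of \<open>B\<close>.\<close>

lemma transpose_kernel_in_range:
  fixes A B :: "real mat"
  assumes A: "A \<in> carrier_mat n m" and B: "B \<in> carrier_mat p n"
    and exact: "\<And>v. v \<in> carrier_vec n \<Longrightarrow> B *\<^sub>v v = 0\<^sub>v p \<Longrightarrow> \<exists>u\<in>carrier_vec m. v = A *\<^sub>v u"
    and y: "y \<in> carrier_vec n" and ker: "transpose_mat A *\<^sub>v y = 0\<^sub>v m"
  shows "\<exists>w\<in>carrier_vec p. y = transpose_mat B *\<^sub>v w"
proof -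
  obtain w where w: "w \<in> carrier_vec p" and Br: "B *\<^sub>v (y - transpose_mat B *\<^sub>v w) = 0\<^sub>v p"
    using ex_row_space_projection[OF B y] by blast
  define z where "z = transpose_mat B *\<^sub>v w"
  define r where "r = y - z"
  have z: "z \<in> carrier_vec n" and r: "r \<in> carrier_vec n"
    using B w y by (auto simp: z_def r_def)
  have Br: "B *\<^sub>v r = 0\<^sub>v p" using Br by (simp add: r_def z_def)
  then obtain u where u: "u \<in> carrier_vec m" "r = A *\<^sub>v u" using exact[OF r] by blast
  have "y \<bullet> r = (transpose_mat A *\<^sub>v y) \<bullet> u"
    using transpose_vec_mult_scalar[OF A u(1) y] u(2) by simp
  then have yr: "y \<bullet> r = 0" using ker u by simp
  have zr: "z \<bullet> r = 0"
    using transpose_vec_mult_scalar[OF B r w] Br w by (simp add: z_def)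
  have "r \<bullet> r = y \<bullet> r - z \<bullet> r"
    using minus_scalar_prod_distrib[OF y z r] by (simp add: r_def)
  then have "(\<Sum>i<n. r $ i * r $ i) = 0"
    unfolding yr zr using r by (simp add: scalar_prod_def atLeast0LessThan)
  then have "\<And>i. i < n \<Longrightarrow> r $ i = 0"
    by (subst (asm) sum_nonneg_eq_0_iff) auto
  then have "y = z"
    using y z by (intro eq_vecI) (auto simp: r_def)
  then show ?thesis using w by (auto simp: z_def)
qed

lemma triple_mult_mat_vec:
  fixes E :: "real mat"
  assumes "E \<in> carrier_mat m m" "A \<in> carrier_mat m n" "D \<in> carrier_mat n n" "v \<in> carrier_vec n"
  shows "(E * A * D) *\<^sub>v v = E *\<^sub>v (A *\<^sub>v (D *\<^sub>v v))"
  using assms by (simp add: assoc_mult_mat_vec[of _ m n _ n] assoc_mult_mat_vec[of _ m m _ n])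

lemma mult_mat_vec_zero:
  fixes A :: "real mat"
  assumes "A \<in> carrier_mat m n"
  shows "A *\<^sub>v 0\<^sub>v n = 0\<^sub>v m"
  using assms by (intro eq_vecI) auto

lemma zero_matI:
  fixes A :: "real mat"
  assumes A: "A \<in> carrier_mat m n"
    and zero: "\<And>v. v \<in> carrier_vec n \<Longrightarrow> A *\<^sub>v v = 0\<^sub>v m"
  shows "A = 0\<^sub>m m n"
proof (rule eq_matI)
  fix i j assume "i < dim_row (0\<^sub>m m n :: real mat)" "j < dim_col (0\<^sub>m m n :: real mat)"
  then have ij: "i < m" "j < n" by auto
  have "(A *\<^sub>v unit_vec n j) $ i = A $$ (i, j)" using A ij by simp
  then show "A $$ (i, j) = 0\<^sub>m m n $$ (i, j)" using zero[of "unit_vec n j"] ij by simp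
qed (use A in auto)

lemma mult_mat_vec_inverse:
  fixes D E :: "real mat"
  assumes "D \<in> carrier_mat n n" "E \<in> carrier_mat n n" "D * E = 1\<^sub>m n" "v \<in> carrier_vec n"
  shows "D *\<^sub>v (E *\<^sub>v v) = v"
  using assms by (metis assoc_mult_mat_vec one_mult_mat_vec)

definition mutually_inverse :: "nat \<Rightarrow> real mat \<Rightarrow> real mat \<Rightarrow> bool" where
  "mutually_inverse n D E \<longleftrightarrow>
     D \<in> carrier_mat n n \<and> E \<in> carrier_mat n n \<and> D * E = 1\<^sub>m n \<and> E * D = 1\<^sub>m n"

lemma weighted_transposes_compose_zero:
  fixes A B :: "real mat"
  assumes A: "A \<in> carrier_mat n m" and B: "B \<in> carrier_mat p n" and BA: "B * A = 0\<^sub>m p m"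
    and E0: "E0 \<in> carrier_mat m m" and D1: "mutually_inverse n D1 E1"
    and D2: "D2 \<in> carrier_mat p p"
    and w: "w \<in> carrier_vec p"
  shows "(E0 * transpose_mat A * D1) *\<^sub>v ((E1 * transpose_mat B * D2) *\<^sub>v w) = 0\<^sub>v m"
proof -
  let ?x = "transpose_mat B *\<^sub>v (D2 *\<^sub>v w)"
  have D1': "D1 \<in> carrier_mat n n" "E1 \<in> carrier_mat n n" "D1 * E1 = 1\<^sub>m n"
    using D1 by (auto simp: mutually_inverse_def)
  have Dw: "D2 *\<^sub>v w \<in> carrier_vec p" using D2 w by auto
  have x: "?x \<in> carrier_vec n" using B Dw by auto
  have BT: "transpose_mat B \<in> carrier_mat n p" and AT: "transpose_mat A \<in> carrier_mat m n"
    using A B by auto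
  have AB: "transpose_mat A * transpose_mat B = 0\<^sub>m m p"
    using transpose_mult[OF B A] BA by (metis transpose_transpose zero_transpose_mat)
  have "(E0 * transpose_mat A * D1) *\<^sub>v ((E1 * transpose_mat B * D2) *\<^sub>v w)
      = (E0 * transpose_mat A * D1) *\<^sub>v (E1 *\<^sub>v ?x)"
    by (simp add: triple_mult_mat_vec[OF D1'(2) BT D2 w])
  also have "\<dots> = E0 *\<^sub>v (transpose_mat A *\<^sub>v (D1 *\<^sub>v (E1 *\<^sub>v ?x)))"
    using D1' x by (intro triple_mult_mat_vec[OF E0 AT]) auto
  also have "\<dots> = E0 *\<^sub>v (transpose_mat A *\<^sub>v ?x)"
    by (simp add: mult_mat_vec_inverse[OF D1' x])
  also have "transpose_mat A *\<^sub>v ?x = (transpose_mat A * transpose_mat B) *\<^sub>v (D2 *\<^sub>v w)"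
    using assoc_mult_mat_vec[OF AT BT Dw] by simp
  also have "\<dots> = 0\<^sub>v m"
    unfolding AB using Dw by (intro eq_vecI) auto
  finally show ?thesis by (simp add: mult_mat_vec_zero[OF E0])
qed

text \<open>With \<open>D\<^sub>i\<close> inverse to \<open>E\<^sub>i\<close>, the left side says that \<open>D\<^sub>1 y\<close> lies in the kernel of \<open>A\<^sup>T\<close>, the
  right side that it lies in the range of \<open>B\<^sup>T\<close>.\<close>

lemma weighted_kernel_iff_range:
  fixes A B :: "real mat"
  assumes A: "A \<in> carrier_mat n m" and B: "B \<in> carrier_mat p n" and BA: "B * A = 0\<^sub>m p m"
    and exact: "\<And>v. v \<in> carrier_vec n \<Longrightarrow> B *\<^sub>v v = 0\<^sub>v p \<Longrightarrow> \<exists>u\<in>carrier_vec m. v = A *\<^sub>v u"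
    and D0: "mutually_inverse m D0 E0" and D1: "mutually_inverse n D1 E1"
    and D2: "mutually_inverse p D2 E2"
    and y: "y \<in> carrier_vec n"
  shows "(E0 * transpose_mat A * D1) *\<^sub>v y = 0\<^sub>v m \<longleftrightarrow>
         (\<exists>w\<in>carrier_vec p. y = (E1 * transpose_mat B * D2) *\<^sub>v w)"
proof
  have D0': "D0 \<in> carrier_mat m m" "E0 \<in> carrier_mat m m" "D0 * E0 = 1\<^sub>m m"
    using D0 by (auto simp: mutually_inverse_def)
  have D1': "E1 \<in> carrier_mat n n" "D1 \<in> carrier_mat n n" "E1 * D1 = 1\<^sub>m n"
    using D1 by (auto simp: mutually_inverse_def)
  have D2': "D2 \<in> carrier_mat p p" "E2 \<in> carrier_mat p p" "D2 * E2 = 1\<^sub>m p"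
    using D2 by (auto simp: mutually_inverse_def)
  have BT: "transpose_mat B \<in> carrier_mat n p" and AT: "transpose_mat A \<in> carrier_mat m n"
    using A B by auto
  {
    assume ker: "(E0 * transpose_mat A * D1) *\<^sub>v y = 0\<^sub>v m"
    have Dy: "D1 *\<^sub>v y \<in> carrier_vec n" using D1' y by auto
    have ADy: "transpose_mat A *\<^sub>v (D1 *\<^sub>v y) \<in> carrier_vec m" using AT Dy by auto
    have "E0 *\<^sub>v (transpose_mat A *\<^sub>v (D1 *\<^sub>v y)) = 0\<^sub>v m"
      using ker by (simp add: triple_mult_mat_vec[OF D0'(2) AT D1'(2) y])
    then have "transpose_mat A *\<^sub>v (D1 *\<^sub>v y) = 0\<^sub>v m"
      using mult_mat_vec_inverse[OF D0' ADy] mult_mat_vec_zero[OF D0'(1)] by simp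
    from transpose_kernel_in_range[OF A B exact Dy this]
    obtain w where w: "w \<in> carrier_vec p" and Dyw: "D1 *\<^sub>v y = transpose_mat B *\<^sub>v w" by blast
    have Ew: "E2 *\<^sub>v w \<in> carrier_vec p" using D2' w by auto
    have "(E1 * transpose_mat B * D2) *\<^sub>v (E2 *\<^sub>v w) = E1 *\<^sub>v (transpose_mat B *\<^sub>v w)"
      by (simp add: triple_mult_mat_vec[OF D1'(1) BT D2'(1) Ew] mult_mat_vec_inverse[OF D2' w])
    also have "\<dots> = y" using mult_mat_vec_inverse[OF D1' y] by (simp add: Dyw)
    finally show "\<exists>w\<in>carrier_vec p. y = (E1 * transpose_mat B * D2) *\<^sub>v w"
      using Ew by metis
  }
  assume "\<exists>w\<in>carrier_vec p. y = (E1 * transpose_mat B * D2) *\<^sub>v w"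
  then show "(E0 * transpose_mat A * D1) *\<^sub>v y = 0\<^sub>v m"
    using weighted_transposes_compose_zero[OF A B BA D0'(2) D1 D2'(1)] by auto
qed

lemma positive_diagonal_inverse:
  assumes "positive_diagonal n D"
  shows "mutually_inverse n D (the (mat_inverse D))"
proof -
  have D: "D \<in> carrier_mat n n" and diag: "diagonal_mat D" and pos: "\<And>i. i < n \<Longrightarrow> D $$ (i, i) > 0"
    using assms by (auto simp: positive_diagonal_def)
  define E where "E = mat n n (\<lambda>(i, j). if i = j then 1 / D $$ (i, i) else 0)"
  have E: "E \<in> carrier_mat n n" by (simp add: E_def)
  have off: "D $$ (i, j) = 0" if "i < n" "j < n" "i \<noteq> j" for i j
    using diag D that by (auto simp: diagonal_mat_def)
  have "D * E = 1\<^sub>m n"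
  proof (rule eq_matI)
    fix i j assume "i < dim_row (1\<^sub>m n :: real mat)" "j < dim_col (1\<^sub>m n :: real mat)"
    then have ij: "i < n" "j < n" by auto
    have "(D * E) $$ (i, j) = (\<Sum>l<n. D $$ (i, l) * (if l = j then 1 / D $$ (l, l) else 0))"
      using D ij by (simp add: E_def scalar_prod_def atLeast0LessThan)
    also have "\<dots> = (\<Sum>l<n. if l = j then D $$ (i, j) / D $$ (j, j) else 0)"
      by (intro sum.cong) auto
    also have "\<dots> = (1\<^sub>m n) $$ (i, j)" using ij off[of i j] pos[of i] by auto
    finally show "(D * E) $$ (i, j) = (1\<^sub>m n) $$ (i, j)" .
  qed (use D E in auto)
  moreover have "E * D = 1\<^sub>m n"
    by (rule mat_mult_left_right_inverse[OF D E calculation])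
  ultimately have "D \<in> Units (ring_mat TYPE(real) n ())"
    using D E by (auto simp: Units_def ring_mat_def)
  then obtain E' where "mat_inverse D = Some E'"
    using mat_inverse(1)[OF D] by fastforce
  then show ?thesis
    using mat_inverse(2)[OF D] D by (auto simp: mutually_inverse_def)
qed

section \<open>Alternating functions on lists\<close>

text \<open>Adjacent swaps generate all permutations, so this is the alternating property without
  reference to positions or lengths; it survives the removal of a common head from all lists.\<close>

definition adjacent_antisym :: "('v list \<Rightarrow> real) \<Rightarrow> bool" where
  "adjacent_antisym \<phi> \<longleftrightarrow> (\<forall>us a b vs. \<phi> (us @ a # b # vs) = - \<phi> (us @ b # a # vs))"

lemma adjacent_antisymD:
  "adjacent_antisym \<phi> \<Longrightarrow> \<phi> (us @ a # b # vs) = - \<phi> (us @ b # a # vs)"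
  unfolding adjacent_antisym_def by blast

text \<open>A swap of entries at distance \<open>n + 1\<close> is an adjacent swap, a swap at distance \<open>n\<close>, and
  another adjacent swap: an odd number of sign changes.\<close>

lemma adjacent_antisym_swap:
  assumes "adjacent_antisym \<phi>"
  shows "\<phi> (us @ a # ws @ b # vs) = - \<phi> (us @ b # ws @ a # vs)"
proof (induction ws arbitrary: us)
  case Nil
  show ?case using adjacent_antisymD[OF assms, of us a b vs] by simp
next
  case (Cons c ws)
  have "\<phi> (us @ a # c # ws @ b # vs) = - \<phi> (us @ c # a # ws @ b # vs)"
    by (rule adjacent_antisymD[OF assms])
  also have "\<dots> = \<phi> (us @ c # b # ws @ a # vs)"
    using Cons.IH[of "us @ [c]"] by simp
  also have "\<dots> = - \<phi> (us @ b # c # ws @ a # vs)"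
    by (rule adjacent_antisymD[OF assms])
  finally show ?case by simp
qed

lemma permute_list_transpose:
  assumes "i < length xs" "j < length xs"
  shows "permute_list (Transposition.transpose i j) xs = xs[i := xs ! j, j := xs ! i]"
  using assms
  by (intro nth_equalityI)
    (simp_all add: permute_list_def Transposition.transpose_def nth_list_update)

lemma permute_list_transpose_split:
  "permute_list (Transposition.transpose (length us) (Suc (length us + length ws)))
     (us @ a # ws @ b # vs) = us @ b # ws @ a # vs"
proof -
  have "(us @ a # ws @ b # vs) ! Suc (length us + length ws) = b"
    by (simp add: nth_append)
  then show ?thesis
    by (subst permute_list_transpose) (simp_all add: list_update_append)
qed

lemma adjacent_antisym_transpose:
  assumes "adjacent_antisym \<phi>" and "i < j" and "j < length xs"
  shows "\<phi> (permute_list (Transposition.transpose i j) xs) = - \<phi> xs"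
proof -
  define us ws vs where "us = take i xs" and "ws = drop (Suc i) (take j xs)" and "vs = drop (Suc j) xs"
  have "take j xs = take i (take j xs) @ take j xs ! i # ws"
    unfolding ws_def using assms(2,3) by (intro id_take_nth_drop) simp
  moreover have "take i (take j xs) = us" "take j xs ! i = xs ! i"
    using assms(2) by (simp_all add: us_def min_def)
  ultimately have "take j xs @ xs ! j # vs = us @ xs ! i # ws @ xs ! j # vs"
    by (metis append_Cons append_assoc)
  then have "xs = us @ xs ! i # ws @ xs ! j # vs"
    unfolding vs_def using id_take_nth_drop[OF assms(3)] by (rule trans[rotated])
  then obtain a b where xs: "xs = us @ a # ws @ b # vs" by blast
  have len: "i = length us" "j = Suc (length us + length ws)"
    using assms(2,3) by (simp_all add: us_def ws_def)
  have "permute_list (Transposition.transpose i j) xs = us @ b # ws @ a # vs"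
    unfolding len xs by (rule permute_list_transpose_split)
  then show ?thesis
    using adjacent_antisym_swap[OF assms(1), of us b ws a vs] by (simp only: xs)
qed

lemma adjacent_antisym_permute:
  assumes anti: "adjacent_antisym \<phi>" and "p permutes {..<length xs}"
  shows "\<phi> (permute_list p xs) = of_int (sign p) * \<phi> xs"
proof -
  have "\<forall>xs. length xs = n \<longrightarrow> \<phi> (permute_list p xs) = of_int (sign p) * \<phi> xs"
    if "p permutes {..<n}" for n
    using that finite_lessThan
  proof (induction rule: permutes_induct)
    case id
    show ?case by simp
  next
    case (swap a b p)
    have sgn: "sign (Transposition.transpose a b \<circ> p) = - sign p"
      using swap by (subst sign_compose)
        (simp_all add: sign_swap_id permutation_swap_id permutes_imp_permutation[OF finite_lessThan])
    show ?case
    proof (intro allI impI)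
      fix xs :: "'a list" assume len: "length xs = n"
      have "\<phi> (permute_list (Transposition.transpose a b) xs) = - \<phi> xs"
        using adjacent_antisym_transpose[OF anti, of a b xs]
          adjacent_antisym_transpose[OF anti, of b a xs] swap len
        by (cases "a < b") (auto simp: transpose_commute)
      then show "\<phi> (permute_list (Transposition.transpose a b \<circ> p) xs)
          = of_int (sign (Transposition.transpose a b \<circ> p)) * \<phi> xs"
        using swap len by (simp add: permute_list_compose sgn)
    qed
  qed
  with assms show ?thesis by blast
qed

lemma ordered_cliques_same_set:
  assumes "set xs = set ys" "distinct xs = distinct ys" "length xs = length ys"
  shows "xs \<in> ordered_cliques K n \<longleftrightarrow> ys \<in> ordered_cliques K n"
  using assms by (auto simp: ordered_cliques_def)

text \<open>Off the complex both sides of the antisymmetry equation vanish, because a swap does not change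
  the underlying set; hence antisymmetry may be required on all lists.\<close>

lemma cochains_iff:
  "\<phi> \<in> cochains K k \<longleftrightarrow>
     (\<forall>xs. xs \<notin> ordered_cliques K (k + 1) \<longrightarrow> \<phi> xs = 0) \<and> adjacent_antisym \<phi>"
  (is "?L \<longleftrightarrow> ?Z \<and> ?A")
proof
  assume L: ?L
  then have Z: ?Z by (auto simp: cochains_def)
  have "\<phi> (us @ a # b # vs) = - \<phi> (us @ b # a # vs)" for us a b vs
  proof (cases "us @ b # a # vs \<in> ordered_cliques K (k + 1)")
    case False
    moreover have "us @ a # b # vs \<notin> ordered_cliques K (k + 1)"
      using False by (subst ordered_cliques_same_set[of _ "us @ b # a # vs"]) auto
    ultimately show ?thesis using Z by simp
  next
    case True
    let ?t = "Transposition.transpose (length us) (Suc (length us))"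
    have "?t permutes {..<k + 1}"
      using True by (intro permutes_swap_id) (auto simp: ordered_cliques_def)
    then have "\<phi> (permute_list ?t (us @ b # a # vs)) = of_int (sign ?t) * \<phi> (us @ b # a # vs)"
      using L True by (auto simp: cochains_def)
    then show ?thesis
      using permute_list_transpose_split[of us "[]" b a vs] by (simp add: sign_swap_id)
  qed
  with Z show "?Z \<and> ?A" unfolding adjacent_antisym_def by blast
next
  assume "?Z \<and> ?A"
  then show ?L
    using adjacent_antisym_permute[of \<phi>] by (auto simp: cochains_def ordered_cliques_def)
qed

section \<open>The coboundary\<close>

text \<open>The formula for the coboundary on all lists, regardless of length and of the complex; only
  in this generality can an induction pass to the tail of a list.\<close>

definition omission_sum :: "('v list \<Rightarrow> real) \<Rightarrow> 'v list \<Rightarrow> real" where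
  "omission_sum \<phi> xs = (\<Sum>j<length xs. (- 1) ^ j * \<phi> (omit_nth j xs))"

lemma omission_sum_Nil [simp]: "omission_sum \<phi> [] = 0"
  by (simp add: omission_sum_def)

lemma omission_sum_Cons:
  "omission_sum \<phi> (x # xs) = \<phi> xs - omission_sum (\<lambda>ys. \<phi> (x # ys)) xs"
  unfolding omission_sum_def
  by (simp add: sum.lessThan_Suc_shift omit_nth_def sum_negf del: sum.lessThan_Suc)

lemma omission_sum_diff:
  "omission_sum (\<lambda>xs. \<phi> xs - \<psi> xs) xs = omission_sum \<phi> xs - omission_sum \<psi> xs"
  by (simp add: omission_sum_def sum_subtractf right_diff_distrib)

lemma omission_sum_uminus: "omission_sum (\<lambda>xs. - \<phi> xs) xs = - omission_sum \<phi> xs"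
  by (simp add: omission_sum_def sum_negf)

text \<open>Applying the recursion twice produces the sum over the tail \<open>xs\<close> with both signs, which
  cancel, and leaves the double sum for \<open>\<phi> (x # \<cdot>)\<close> over the shorter list.\<close>

lemma omission_sum_twice: "omission_sum (omission_sum \<phi>) xs = 0"
proof (induction xs arbitrary: \<phi>)
  case (Cons x xs)
  then show ?case by (simp add: omission_sum_Cons omission_sum_diff)
qed simp

text \<open>When the swapped entries stand at the front, the terms omitting one of them are exchanged with
  opposite signs. A head \<open>u\<close> before them is split off by the recursion, since \<open>\<phi> (u # \<cdot>)\<close> is again
  antisymmetric.\<close>

lemma omission_sum_antisym:
  assumes "adjacent_antisym \<phi>"
  shows "adjacent_antisym (omission_sum \<phi>)"
proof -
  have "omission_sum \<phi> (us @ a # b # vs) = - omission_sum \<phi> (us @ b # a # vs)" for us a b vs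
    using assms
  proof (induction us arbitrary: \<phi>)
    case Nil
    have "(\<lambda>ys. \<phi> (a # b # ys)) = (\<lambda>ys. - \<phi> (b # a # ys))"
      using adjacent_antisymD[OF Nil, of "[]" a b] by auto
    then show ?case by (simp add: omission_sum_Cons omission_sum_uminus)
  next
    case (Cons u us)
    have "adjacent_antisym (\<lambda>ys. \<phi> (u # ys))"
      unfolding adjacent_antisym_def
      by (intro allI) (rule adjacent_antisymD[OF Cons.prems, of "u # _", simplified])
    from Cons.IH[OF this] show ?case
      using adjacent_antisymD[OF Cons.prems, of us a b vs] by (simp add: omission_sum_Cons)
  qed
  then show ?thesis unfolding adjacent_antisym_def by blast
qed

lemma coboundary_eq_omission_sum:
  "coboundary K k \<phi> xs = (if xs \<in> ordered_cliques K (k + 2) then omission_sum \<phi> xs else 0)"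
proof -
  have "{0..k + 1} = {..<k + 2}" by auto
  then show ?thesis
    by (auto simp: coboundary_def omission_sum_def ordered_cliques_def)
qed

lemma coboundary_in_cochains:
  assumes "\<phi> \<in> cochains K k"
  shows "coboundary K k \<phi> \<in> cochains K (k + 1)"
proof -
  have anti: "adjacent_antisym (omission_sum \<phi>)"
    using assms omission_sum_antisym by (auto simp: cochains_iff)
  have "us @ a # b # vs \<in> ordered_cliques K (k + 2) \<longleftrightarrow> us @ b # a # vs \<in> ordered_cliques K (k + 2)"
    for us a b vs
    by (rule ordered_cliques_same_set) auto
  then have "coboundary K k \<phi> (us @ a # b # vs) = - coboundary K k \<phi> (us @ b # a # vs)"
    for us a b vs
    using adjacent_antisymD[OF anti, of us a b vs] by (simp add: coboundary_eq_omission_sum)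
  then have "adjacent_antisym (coboundary K k \<phi>)"
    unfolding adjacent_antisym_def by blast
  then show ?thesis by (simp add: cochains_iff coboundary_eq_omission_sum)
qed

lemma omit_nth_ordered_clique:
  assumes "clique_complex d V K" "xs \<in> ordered_cliques K (n + 2)" "j < n + 2"
  shows "omit_nth j xs \<in> ordered_cliques K (n + 1)"
proof -
  have xs: "distinct xs" "length xs = n + 2" "set xs \<in> K"
    using assms(2) by (auto simp: ordered_cliques_def)
  have len: "length (omit_nth j xs) = n + 1"
    using xs(2) assms(3) by (simp add: omit_nth_def)
  have "distinct (omit_nth j xs)"
    using xs(1) by (auto simp: omit_nth_def set_take_disj_set_drop_if_distinct)
  moreover have "set (omit_nth j xs) \<subseteq> set xs"
    by (auto simp: omit_nth_def dest: in_set_takeD in_set_dropD)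
  moreover have "set (omit_nth j xs) \<noteq> {}" using len by auto
  ultimately show ?thesis
    using assms(1) xs(3) len unfolding clique_complex_def ordered_cliques_def by blast
qed

lemma coboundary_coboundary:
  assumes "clique_complex d V K"
  shows "coboundary K (k + 1) (coboundary K k \<phi>) = (\<lambda>_. 0)"
proof
  fix xs
  show "coboundary K (k + 1) (coboundary K k \<phi>) xs = 0"
  proof (cases "xs \<in> ordered_cliques K (k + 1 + 2)")
    case True
    have "omission_sum (coboundary K k \<phi>) xs = omission_sum (omission_sum \<phi>) xs"
      unfolding omission_sum_def[of _ xs]
    proof (rule sum.cong)
      fix j assume "j \<in> {..<length xs}"
      then have "omit_nth j xs \<in> ordered_cliques K (k + 2)"
        using omit_nth_ordered_clique[OF assms True, of j] True by (auto simp: ordered_cliques_def)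
      then show "(- 1) ^ j * coboundary K k \<phi> (omit_nth j xs)
          = (- 1) ^ j * omission_sum \<phi> (omit_nth j xs)"
        by (simp add: coboundary_eq_omission_sum)
    qed simp
    then show ?thesis by (subst coboundary_eq_omission_sum) (simp add: omission_sum_twice)
  qed (subst coboundary_eq_omission_sum, simp)
qed

lemma coboundary_sum:
  "coboundary K k (\<lambda>xs. \<Sum>j<n. c j * f j xs) xs = (\<Sum>j<n. c j * coboundary K k (f j) xs)"
  by (simp add: coboundary_eq_omission_sum omission_sum_def sum_distrib_left mult.left_commute
      sum.swap[of _ "{..<n}"])

lemma cochains_sum:
  assumes "\<And>j. j < n \<Longrightarrow> f j \<in> cochains K k"
  shows "(\<lambda>xs. \<Sum>j<n. c j * f j xs) \<in> cochains K k"
  using assms by (auto simp: cochains_def sum_distrib_left mult.left_commute intro!: sum.cong)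

lemma zero_in_cochains: "(\<lambda>_. 0) \<in> cochains K k"
  by (simp add: cochains_def)

section \<open>Coordinates\<close>

lemma orientation_representative:
  assumes or: "orientation K d B" and k: "k \<le> d" and xs: "xs \<in> ordered_cliques K (k + 1)"
  shows "\<exists>i<length (B k). \<exists>p. p permutes {..<k + 1} \<and> permute_list p (B k ! i) = xs"
proof -
  have bij: "bij_betw set (set (B k)) (cliques K (k + 1))"
    and sub: "set (B k) \<subseteq> ordered_cliques K (k + 1)"
    using or k by (auto simp: orientation_def)
  have "set xs \<in> cliques K (k + 1)"
    using xs by (auto simp: ordered_cliques_def cliques_def distinct_card)
  then obtain b where b: "b \<in> set (B k)" "set b = set xs"
    using bij by (metis bij_betw_imp_surj_on imageE)
  then have "distinct b" "length b = k + 1" using sub by (auto simp: ordered_cliques_def)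
  then have "mset xs = mset b"
    using b xs by (intro set_eq_iff_mset_eq_distinct[THEN iffD1]) (auto simp: ordered_cliques_def)
  then obtain p where "p permutes {..<length b}" "permute_list p b = xs"
    by (rule mset_eq_permutation)
  with b \<open>length b = k + 1\<close> show ?thesis by (auto simp: in_set_conv_nth)
qed

lemma orientation_representative_unique:
  assumes or: "orientation K d B" and k: "k \<le> d"
    and i: "i < length (B k)" and j: "j < length (B k)"
    and p: "p permutes {..<k + 1}" and q: "q permutes {..<k + 1}"
    and eq: "permute_list p (B k ! i) = permute_list q (B k ! j)"
  shows "i = j \<and> p = q"
proof
  have bij: "bij_betw set (set (B k)) (cliques K (k + 1))"
    and sub: "set (B k) \<subseteq> ordered_cliques K (k + 1)" and dist: "distinct (B k)"
    using or k by (auto simp: orientation_def)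
  have bi: "distinct (B k ! i)" "length (B k ! i) = k + 1" and bj: "length (B k ! j) = k + 1"
    using sub nth_mem[OF i] nth_mem[OF j] by (auto simp: ordered_cliques_def)
  have "set (B k ! i) = set (B k ! j)"
    using p q bi bj set_permute_list[of p "B k ! i"] set_permute_list[of q "B k ! j"] eq by simp
  then have "B k ! i = B k ! j"
    using bij nth_mem[OF i] nth_mem[OF j] by (auto simp: bij_betw_def inj_on_def)
  then show ij: "i = j" using dist i j by (simp add: nth_eq_iff_index_eq)
  show "p = q"
  proof
    fix l
    show "p l = q l"
    proof (cases "l < k + 1")
      case True
      then have "B k ! i ! p l = B k ! i ! q l"
        using eq ij p q bi permute_list_nth[of p "B k ! i" l] permute_list_nth[of q "B k ! i" l] by simp
      moreover have "p l < k + 1" "q l < k + 1"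
        using True p q by (metis lessThan_iff permutes_in_image)+
      ultimately show ?thesis using bi by (simp add: nth_eq_iff_index_eq)
    next
      case False
      then show ?thesis using p q by (simp add: permutes_not_in)
    qed
  qed
qed

text \<open>An ordered clique arises from exactly one chosen orientation by exactly one permutation, so
  a vector extends to exactly one alternating function.\<close>

lemma coords_bij:
  assumes or: "orientation K d B" and k: "k \<le> d"
  shows "bij_betw (coords B k) (cochains K k) (carrier_vec (length (B k)))"
proof (rule bij_betwI')
  fix \<phi> \<psi> assume \<phi>: "\<phi> \<in> cochains K k" and \<psi>: "\<psi> \<in> cochains K k"
  have sub: "set (B k) \<subseteq> ordered_cliques K (k + 1)"
    using or k by (auto simp: orientation_def)
  show "coords B k \<phi> = coords B k \<psi> \<longleftrightarrow> \<phi> = \<psi>"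
  proof
    assume eq: "coords B k \<phi> = coords B k \<psi>"
    show "\<phi> = \<psi>"
    proof
      fix xs
      show "\<phi> xs = \<psi> xs"
      proof (cases "xs \<in> ordered_cliques K (k + 1)")
        case True
        then obtain i p where i: "i < length (B k)" and p: "p permutes {..<k + 1}"
          and xs: "permute_list p (B k ! i) = xs"
          using orientation_representative[OF or k] by blast
        have "\<phi> (B k ! i) = \<psi> (B k ! i)"
          using arg_cong[OF eq, of "\<lambda>v. v $ i"] i by (simp add: coords_def)
        moreover have "B k ! i \<in> ordered_cliques K (k + 1)" using sub i by auto
        ultimately show ?thesis
          using \<phi> \<psi> p unfolding cochains_def xs[symmetric] by auto
      next
        case False
        then show ?thesis using \<phi> \<psi> by (simp add: cochains_iff)
      qed
    qed
  qed simp
next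
  fix \<phi> show "coords B k \<phi> \<in> carrier_vec (length (B k))" by (simp add: coords_def)
next
  fix v :: "real vec" assume v: "v \<in> carrier_vec (length (B k))"
  have sub: "set (B k) \<subseteq> ordered_cliques K (k + 1)"
    using or k by (auto simp: orientation_def)
  let ?P = "\<lambda>xs i p. i < length (B k) \<and> p permutes {..<k + 1} \<and> permute_list p (B k ! i) = xs"
  \<comment> \<open>The alternating extension of \<open>v\<close>; the value is well defined because \<open>i\<close> and \<open>p\<close> are unique.\<close>
  define \<phi> where "\<phi> xs = (if xs \<in> ordered_cliques K (k + 1)
      then THE r. \<exists>i p. ?P xs i p \<and> r = of_int (sign p) * v $ i else 0)" for xs
  have \<phi>: "\<phi> xs = of_int (sign p) * v $ i"
    if "xs \<in> ordered_cliques K (k + 1)" "?P xs i p" for xs i p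
  proof -
    have "(THE r. \<exists>i p. ?P xs i p \<and> r = of_int (sign p) * v $ i) = of_int (sign p) * v $ i"
    proof (rule the_equality)
      fix r assume "\<exists>i p. ?P xs i p \<and> r = of_int (sign p) * v $ i"
      then show "r = of_int (sign p) * v $ i"
        using that(2) orientation_representative_unique[OF or k] by metis
    qed (use that(2) in blast)
    with that(1) show ?thesis by (simp add: \<phi>_def)
  qed
  have "\<phi> \<in> cochains K k"
  proof -
    have "\<phi> (permute_list q xs) = of_int (sign q) * \<phi> xs"
      if xs: "xs \<in> ordered_cliques K (k + 1)" and q: "q permutes {..<k + 1}" for xs q
    proof -
      obtain i p where P: "?P xs i p"
        using orientation_representative[OF or k xs] by blast
      have len: "length xs = k + 1" "length (B k ! i) = k + 1"
        using xs P sub nth_mem[of i "B k"] by (auto simp: ordered_cliques_def)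
      have q': "permute_list q xs \<in> ordered_cliques K (k + 1)"
        using xs q len by (subst ordered_cliques_same_set[of _ xs]) simp_all
      have "?P (permute_list q xs) i (p \<circ> q)"
        using P q len permute_list_compose[of q "B k ! i" p] by (auto intro: permutes_compose)
      moreover have "sign (p \<circ> q) = sign p * sign q"
        using P q by (intro sign_compose permutes_imp_permutation[OF finite_lessThan[of "k + 1"]]) simp_all
      ultimately show ?thesis using \<phi>[OF q'] \<phi>[OF xs P] by simp
    qed
    then show ?thesis by (auto simp: cochains_def \<phi>_def)
  qed
  moreover have "v = coords B k \<phi>"
  proof (rule eq_vecI)
    fix i assume "i < dim_vec (coords B k \<phi>)"
    then have i: "i < length (B k)" by (simp add: coords_def)
    then have "B k ! i \<in> ordered_cliques K (k + 1)" using sub by auto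
    then have "\<phi> (B k ! i) = of_int (sign id) * v $ i"
      using i \<phi>[of "B k ! i" i id] by (simp add: permutes_id)
    then show "v $ i = coords B k \<phi> $ i" using i by (simp add: coords_def)
  qed (use v in \<open>simp add: coords_def\<close>)
  ultimately show "\<exists>\<phi>\<in>cochains K k. v = coords B k \<phi>" by blast
qed

lemma coords_carrier [simp]: "coords B k \<phi> \<in> carrier_vec (length (B k))"
  by (simp add: coords_def)

lemma coords_zero: "coords B k (\<lambda>_. 0) = 0\<^sub>v (length (B k))"
  by (auto simp: coords_def)

context
  fixes d K B k
  assumes or: "orientation K d B" and k: "k \<le> d"
begin

lemma of_coords_in_cochains:
  assumes "v \<in> carrier_vec (length (B k))"
  shows "of_coords K B k v \<in> cochains K k"
  using bij_betw_the_inv_into[OF coords_bij[OF or k]] assms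
  by (auto simp: of_coords_def bij_betw_def)

lemma coords_of_coords:
  assumes "v \<in> carrier_vec (length (B k))"
  shows "coords B k (of_coords K B k v) = v"
  unfolding of_coords_def using f_the_inv_into_f_bij_betw[OF coords_bij[OF or k]] assms by blast

lemma coords_eq_iff:
  assumes "\<phi> \<in> cochains K k" "\<psi> \<in> cochains K k"
  shows "coords B k \<phi> = coords B k \<psi> \<longleftrightarrow> \<phi> = \<psi>"
  using coords_bij[OF or k] assms by (auto simp: bij_betw_def inj_on_def)

lemma coords_eq_zero_iff:
  assumes "\<phi> \<in> cochains K k"
  shows "coords B k \<phi> = 0\<^sub>v (length (B k)) \<longleftrightarrow> \<phi> = (\<lambda>_. 0)"
  using coords_eq_iff[OF assms zero_in_cochains] by (simp add: coords_zero)

text \<open>The matrix of the coboundary is defined by its values on the cochains dual to the chosen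
  orientations; writing a cochain as their linear combination shows that it acts as it should.\<close>

lemma cochain_unit_expansion:
  assumes "\<phi> \<in> cochains K k"
  shows "\<phi> = (\<lambda>xs. \<Sum>j<length (B k). coords B k \<phi> $ j
                   * of_coords K B k (unit_vec (length (B k)) j) xs)"
    (is "_ = ?\<psi>")
proof -
  let ?n = "length (B k)"
  have unit: "of_coords K B k (unit_vec ?n j) (B k ! i) = (if i = j then 1 else 0)"
    if "i < ?n" "j < ?n" for i j
    using arg_cong[OF coords_of_coords[of "unit_vec ?n j"], of "\<lambda>v. v $ i"] that
    by (simp add: coords_def)
  have "?\<psi> \<in> cochains K k"
    by (rule cochains_sum) (simp add: of_coords_in_cochains)
  moreover have "coords B k \<phi> = coords B k ?\<psi>"
  proof (rule eq_vecI)
    fix i assume "i < dim_vec (coords B k ?\<psi>)"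
    then have i: "i < ?n" by (simp add: coords_def)
    have "coords B k ?\<psi> $ i = ?\<psi> (B k ! i)"
      using i by (simp add: coords_def[of B k ?\<psi>])
    also have "\<dots> = (\<Sum>j<?n. if j = i then coords B k \<phi> $ i else 0)"
      using i by (intro sum.cong) (auto simp: unit)
    finally show "coords B k \<phi> $ i = coords B k ?\<psi> $ i" using i by simp
  qed (simp add: coords_def)
  ultimately show ?thesis using coords_eq_iff[OF assms] by blast
qed

lemma coords_coboundary:
  assumes "\<phi> \<in> cochains K k"
  shows "coords B (k + 1) (coboundary K k \<phi>) = coboundary_mat K B k *\<^sub>v coords B k \<phi>"
    (is "?l = ?r")
proof (rule eq_vecI)
  fix i assume "i < dim_vec ?r"
  then have i: "i < length (B (k + 1))" by (simp add: coboundary_mat_def)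
  have "?l $ i = (\<Sum>j<length (B k). coords B k \<phi> $ j
      * coboundary K k (of_coords K B k (unit_vec (length (B k)) j)) (B (k + 1) ! i))"
    using i arg_cong[OF cochain_unit_expansion[OF assms], of "\<lambda>f. coboundary K k f (B (k + 1) ! i)"]
    unfolding coboundary_sum by (simp add: coords_def[of B "k + 1", simplified])
  also have "\<dots> = ?r $ i"
    using i by (simp add: coboundary_mat_def scalar_prod_def coords_def atLeast0LessThan mult.commute)
  finally show "?l $ i = ?r $ i" .
qed (simp add: coords_def coboundary_mat_def)

end

lemma coboundary_mat_carrier:
  "coboundary_mat K B k \<in> carrier_mat (length (B (k + 1))) (length (B k))"
  by (simp add: coboundary_mat_def)

lemma coboundary_mat_compose:
  assumes cc: "clique_complex d V K" and or: "orientation K d B" and k: "k + 1 \<le> d"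
  shows "coboundary_mat K B (k + 1) * coboundary_mat K B k
       = 0\<^sub>m (length (B (k + 2))) (length (B k))"
proof (rule zero_matI)
  let ?M = "coboundary_mat K B k" and ?M' = "coboundary_mat K B (k + 1)"
  have M: "?M \<in> carrier_mat (length (B (k + 1))) (length (B k))"
    and M': "?M' \<in> carrier_mat (length (B (k + 2))) (length (B (k + 1)))"
    using coboundary_mat_carrier[of K B] coboundary_mat_carrier[of K B "k + 1"] by simp_all
  have k': "k \<le> d" using k by simp
  show "?M' * ?M \<in> carrier_mat (length (B (k + 2))) (length (B k))" using M M' by auto
  fix v :: "real vec" assume v: "v \<in> carrier_vec (length (B k))"
  let ?\<phi> = "of_coords K B k v"
  have \<phi>: "?\<phi> \<in> cochains K k" by (rule of_coords_in_cochains[OF or k' v])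
  have "(?M' * ?M) *\<^sub>v v = ?M' *\<^sub>v (?M *\<^sub>v v)" by (rule assoc_mult_mat_vec[OF M' M v])
  also have "\<dots> = coords B (k + 2) (coboundary K (k + 1) (coboundary K k ?\<phi>))"
    using coords_coboundary[OF or k coboundary_in_cochains[OF \<phi>]] coords_coboundary[OF or k' \<phi>]
    by (simp add: coords_of_coords[OF or k' v])
  also have "\<dots> = 0\<^sub>v (length (B (k + 2)))"
    unfolding coboundary_coboundary[OF cc] by (rule coords_zero)
  finally show "(?M' * ?M) *\<^sub>v v = 0\<^sub>v (length (B (k + 2)))" .
qed

lemma weighted_codiff_mat_carrier:
  assumes "mutually_inverse (length (B k)) (D k) (the (mat_inverse (D k)))"
    and "D (k + 1) \<in> carrier_mat (length (B (k + 1))) (length (B (k + 1)))"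
  shows "weighted_codiff_mat K B D k \<in> carrier_mat (length (B k)) (length (B (k + 1)))"
  using assms by (auto simp: weighted_codiff_mat_def mutually_inverse_def coboundary_mat_def)

section \<open>Exactness of the weighted dual sequence\<close>

theorem theorem3p2:
  fixes d :: nat and V :: "'v set" and K :: "'v set set"
    and B :: "nat \<Rightarrow> 'v list list" and D :: "nat \<Rightarrow> real mat"
  assumes "d \<ge> 1"
    and "clique_complex d V K"
    and "orientation K d B"
    and "\<And>k. k \<le> d \<Longrightarrow> positive_diagonal (length (B k)) (D k)"
  shows "((\<forall>k. 1 \<le> k \<and> k \<le> d - 1 \<longrightarrow>
             ker_on (cochains K k) (coboundary K k) =
               coboundary K (k - 1) ` cochains K (k - 1)) \<longrightarrow>
          (\<forall>k. 1 \<le> k \<and> k \<le> d - 1 \<longrightarrow>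
             ker_on (cochains K k) (weighted_codiff K B D (k - 1)) =
               weighted_codiff K B D k ` cochains K (k + 1)))
       \<and> (\<forall>k. k + 2 \<le> d \<longrightarrow>
            (\<forall>\<psi>\<in>cochains K (k + 2).
               weighted_codiff K B D k (weighted_codiff K B D (k + 1) \<psi>) = (\<lambda>_. 0)))"
proof -
  note cc = assms(2) and or = assms(3)
  let ?N = "\<lambda>k. length (B k)" and ?M = "coboundary_mat K B" and ?W = "weighted_codiff_mat K B D"
  have inv: "mutually_inverse (?N k) (D k) (the (mat_inverse (D k)))" if "k \<le> d" for k
    using positive_diagonal_inverse[OF assms(4)[OF that]] .
  have D: "D k \<in> carrier_mat (?N k) (?N k)" "the (mat_inverse (D k)) \<in> carrier_mat (?N k) (?N k)"
    if "k \<le> d" for k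
    using inv[OF that] by (auto simp: mutually_inverse_def)
  have W: "?W k *\<^sub>v v \<in> carrier_vec (?N k)" if "k + 1 \<le> d" "v \<in> carrier_vec (?N (k + 1))" for k v
    using weighted_codiff_mat_carrier[where B=B and D=D and k=k and K=K] inv[of k] D[OF that(1)] that
    by auto
  have codiff: "weighted_codiff K B D k \<psi> \<in> cochains K k"
    "coords B k (weighted_codiff K B D k \<psi>) = ?W k *\<^sub>v coords B (k + 1) \<psi>"
    if "k + 1 \<le> d" for k \<psi>
    using W[OF that coords_carrier[of B "k + 1" \<psi>]] that
    by (auto simp: weighted_codiff_def of_coords_in_cochains[OF or] coords_of_coords[OF or])
  have codiff_zero: "weighted_codiff K B D k \<psi> = (\<lambda>_. 0) \<longleftrightarrow>
      ?W k *\<^sub>v coords B (k + 1) \<psi> = 0\<^sub>v (?N k)" if "k + 1 \<le> d" for k \<psi>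
    using coords_eq_zero_iff[OF or _ codiff(1)[OF that]] codiff(2)[OF that] that by simp
  have M: "?M k \<in> carrier_mat (?N (k + 1)) (?N k)"
    "?M (k + 1) \<in> carrier_mat (?N (k + 2)) (?N (k + 1))" for k
    using coboundary_mat_carrier[of K B k] coboundary_mat_carrier[of K B "k + 1"] by simp_all

  have dual: "ker_on (cochains K (k + 1)) (weighted_codiff K B D k) =
      weighted_codiff K B D (k + 1) ` cochains K (k + 2)"
    if k: "k + 2 \<le> d" and exact: "ker_on (cochains K (k + 1)) (coboundary K (k + 1)) =
      coboundary K k ` cochains K k" for k
  proof -
    have le: "k \<le> d" "k + 1 \<le> d" "k + 1 + 1 \<le> d" using k by auto
    have exact_mat: "\<exists>u\<in>carrier_vec (?N k). v = ?M k *\<^sub>v u"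
      if v: "v \<in> carrier_vec (?N (k + 1))" and zero: "?M (k + 1) *\<^sub>v v = 0\<^sub>v (?N (k + 2))" for v
    proof -
      let ?\<phi> = "of_coords K B (k + 1) v"
      have \<phi>: "?\<phi> \<in> cochains K (k + 1)" and v\<phi>: "coords B (k + 1) ?\<phi> = v"
        using of_coords_in_cochains[OF or le(2) v] coords_of_coords[OF or le(2) v] by auto
      have "coords B (k + 1 + 1) (coboundary K (k + 1) ?\<phi>) = 0\<^sub>v (?N (k + 1 + 1))"
        using coords_coboundary[OF or le(2) \<phi>] v\<phi> zero by simp
      then have "coboundary K (k + 1) ?\<phi> = (\<lambda>_. 0)"
        using coords_eq_zero_iff[OF or le(3) coboundary_in_cochains[OF \<phi>]] by blast
      then have "?\<phi> \<in> ker_on (cochains K (k + 1)) (coboundary K (k + 1))"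
        using \<phi> by (simp add: ker_on_def)
      then obtain \<psi> where \<psi>: "\<psi> \<in> cochains K k" "?\<phi> = coboundary K k \<psi>"
        using exact by auto
      then have "v = ?M k *\<^sub>v coords B k \<psi>"
        using v\<phi> coords_coboundary[OF or le(1) \<psi>(1)] by simp
      then show ?thesis by auto
    qed
    have duality: "?W k *\<^sub>v y = 0\<^sub>v (?N k) \<longleftrightarrow>
        (\<exists>w\<in>carrier_vec (?N (k + 2)). y = ?W (k + 1) *\<^sub>v w)"
      if "y \<in> carrier_vec (?N (k + 1))" for y
      using weighted_kernel_iff_range[OF M coboundary_mat_compose[OF cc or le(2)] exact_mat
          inv[OF le(1)] inv[OF le(2)] inv[OF k] that]
      by (simp add: weighted_codiff_mat_def)
    show ?thesis
    proof (intro subset_antisym subsetI)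
      fix \<phi> assume "\<phi> \<in> ker_on (cochains K (k + 1)) (weighted_codiff K B D k)"
      then have \<phi>: "\<phi> \<in> cochains K (k + 1)" "?W k *\<^sub>v coords B (k + 1) \<phi> = 0\<^sub>v (?N k)"
        using codiff_zero[OF le(2)] by (auto simp: ker_on_def)
      then obtain w where w: "w \<in> carrier_vec (?N (k + 2))" "coords B (k + 1) \<phi> = ?W (k + 1) *\<^sub>v w"
        using duality by auto
      let ?\<psi> = "of_coords K B (k + 2) w"
      have \<psi>: "?\<psi> \<in> cochains K (k + 2)" "coords B (k + 2) ?\<psi> = w"
        using of_coords_in_cochains[OF or k w(1)] coords_of_coords[OF or k w(1)] by auto
      have "coords B (k + 1) \<phi> = coords B (k + 1) (weighted_codiff K B D (k + 1) ?\<psi>)"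
        using codiff(2)[OF le(3), of ?\<psi>] \<psi>(2) w(2) by simp
      then have "\<phi> = weighted_codiff K B D (k + 1) ?\<psi>"
        using coords_eq_iff[OF or le(2) \<phi>(1) codiff(1)[OF le(3)]] by blast
      with \<psi>(1) show "\<phi> \<in> weighted_codiff K B D (k + 1) ` cochains K (k + 2)" by blast
    next
      fix \<phi> assume "\<phi> \<in> weighted_codiff K B D (k + 1) ` cochains K (k + 2)"
      then obtain \<psi> where \<psi>: "\<phi> = weighted_codiff K B D (k + 1) \<psi>" by blast
      have "coords B (k + 1) \<phi> = ?W (k + 1) *\<^sub>v coords B (k + 2) \<psi>"
        using codiff(2)[OF le(3), of \<psi>] \<psi> by simp
      then have "?W k *\<^sub>v coords B (k + 1) \<phi> = 0\<^sub>v (?N k)"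
        using duality[of "coords B (k + 1) \<phi>"] coords_carrier by blast
      then show "\<phi> \<in> ker_on (cochains K (k + 1)) (weighted_codiff K B D k)"
        using codiff_zero[OF le(2)] codiff(1)[OF le(3)] \<psi> by (auto simp: ker_on_def)
    qed
  qed

  have compose: "weighted_codiff K B D k (weighted_codiff K B D (k + 1) \<psi>) = (\<lambda>_. 0)"
    if k: "k + 2 \<le> d" for k \<psi>
  proof -
    have le: "k \<le> d" "k + 1 \<le> d" "k + 1 + 1 \<le> d" using k by auto
    have "?W k *\<^sub>v (?W (k + 1) *\<^sub>v coords B (k + 2) \<psi>) = 0\<^sub>v (?N k)"
      using weighted_transposes_compose_zero[OF M coboundary_mat_compose[OF cc or le(2)]
          D(2)[OF le(1)] inv[OF le(2)] D(1)[OF k] coords_carrier[of B "k + 2" \<psi>]]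
      by (simp add: weighted_codiff_mat_def)
    then show ?thesis
      using codiff_zero[OF le(2)] codiff(2)[OF le(3), of \<psi>] by simp
  qed

  show ?thesis
  proof (intro conjI impI allI ballI)
    fix k assume exact: "\<forall>k. 1 \<le> k \<and> k \<le> d - 1 \<longrightarrow>
        ker_on (cochains K k) (coboundary K k) = coboundary K (k - 1) ` cochains K (k - 1)"
      and k: "1 \<le> k \<and> k \<le> d - 1"
    obtain l where l: "k = l + 1" using k by (metis le_add_diff_inverse2)
    have "ker_on (cochains K (l + 1)) (coboundary K (l + 1)) = coboundary K l ` cochains K l"
      using exact[rule_format, OF k] l by simp
    then show "ker_on (cochains K k) (weighted_codiff K B D (k - 1)) =
        weighted_codiff K B D k ` cochains K (k + 1)"
      using dual[of l] k l by simp
  next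
    fix k \<psi> assume "k + 2 \<le> d"
    then show "weighted_codiff K B D k (weighted_codiff K B D (k + 1) \<psi>) = (\<lambda>_. 0)"
      by (rule compose)
  qed
qed

end
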